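(* For every nonempty list $U$ of positive integers, the number $K_U^L(p,t)$ is independent of $L$; write $K_U(p,t)$ for it. Then, for all (possibly empty) lists $U,V,L$ of positive integers and all $p\in\mathbb N$, $$W_p(UL)=\sum_{t\geq0}K_U(p,t)\,W_t(L)\qquad\text{and}\qquad K_{UV}=K_UK_V .$$ In particular $K_{(\ell_1,\ldots,\ell_s)}=K_{(\ell_1)}\cdots K_{(\ell_s)}$, and for $L=(\ell_1,\ldots,\ell_s)$ $$W_p(L)=\sum_{t\geq0}(K_{(\ell_1)}K_{(\ell_2)}\cdots K_{(\ell_s)})(p,t)\,W_t(\varnothing).$$
   Context: $\mathbb N=\{0,1,2,\ldots\}$. A state is a pair $(p,L)$ with $p\in\mathbb N$ (the control) and $L$ a finite, possibly empty, list of positive integers (the stack). Juxtaposition of lists is concatenation, and $\mathrm{nz}(x_1,\ldots,x_r)$ is the list obtained by deleting every zero entry. The transitions from $(p,L)$ are the following; differently indexed transitions are distinct even when their targets coincide. - Base moves: one for each $0\leq h<p$. If $L=(\ell)L'$ is nonempty, the target is $(h,(\ell+p-1-h)L')$; if $L=\varnothing$, the target is $(h,\mathrm{nz}(p-1-h))$. - Active-head moves: if $L=(\ell)L'$ is nonempty, one for each pair $a,b\geq0$ with $a+b=\ell-1$, with target $(p,\mathrm{nz}(a,b)L')$. $W_p(L)$ is defined by: for $L=(\ell)L'$ with $\ell\ge1$, $$W_p((\ell)L')=\sum_{h=0}^{p-1}W_h((\ell+p-1-h)L')+\sum_{a,b\ge0,\ a+b=\ell-1}W_p(\mathrm{nz}(a,b)L'),$$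 and $W_0(\varnothing)=1$, $W_p(\varnothing)=W_{p-1}(\varnothing)+\sum_{h=0}^{p-2}W_h((p-1-h))$ for $p\geq1$. (This is well defined, since $p$ plus the sum of the entries of $L$ drops by one along each transition.) A path is a finite sequence of consecutive transitions. A state is an exposure of $L$ if its stack is exactly $L$. For a nonempty list $U$ and a list $L$, a path starting at $(p,UL)$ is stopped (with respect to the marked suffix $L$) if it ends at an exposure of $L$ and contains no earlier exposure of $L$. $K_U^L(p,t)$ is the number of stopped paths from $(p,UL)$ to $(t,L)$. For the empty list, $K_\varnothing$ is the identity kernel: $K_\varnothing(p,t)=1$ if $p=t$ and $0$ otherwise. Kernels are multiplied as matrices: $(AB)(p,t)=\sum_{u\geq0}A(p,u)B(u,t)$. *)

theory Defs
  imports Complex_Main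
begin

text \<open>Lists of positive integers are encoded as lists of naturals satisfying \<open>positive\<close>.\<close>

definition positive :: "nat list \<Rightarrow> bool" where
  "positive L \<longleftrightarrow> (\<forall>x\<in>set L. 0 < x)"

definition nz :: "nat list \<Rightarrow> nat list" where
  "nz xs = filter (\<lambda>x. x \<noteq> 0) xs"

type_synonym state = "nat \<times> nat list"

text \<open>Transitions carry their index, so that differently indexed transitions with the same
  source and target stay distinct. As \<open>h < p\<close>, the truncated subtractions below are exact.\<close>

datatype move = Base nat | Head nat nat

inductive transition :: "state \<Rightarrow> move \<Rightarrow> state \<Rightarrow> bool" where
  base_Cons: "h < p \<Longrightarrow> transition (p, l # L) (Base h) (h, (l + p - 1 - h) # L)"
| base_Nil: "h < p \<Longrightarrow> transition (p, []) (Base h) (h, nz [p - 1 - h])"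
| active_head: "a + b + 1 = l \<Longrightarrow> transition (p, l # L) (Head a b) (p, nz [a, b] @ L)"

lemma transition_positive:
  assumes "transition s m s'" "positive (snd s)"
  shows "positive (snd s')"
  using assms by cases (auto simp: positive_def nz_def)

lemma sum_list_nz [simp]: "sum_list (nz xs) = sum_list xs"
  by (induction xs) (auto simp: nz_def)

lemma transition_decreases:
  assumes "transition s m s'"
  shows "fst s' + sum_list (snd s') + 1 = fst s + sum_list (snd s)"
  using assms by cases auto

text \<open>Only the values on positive lists matter; a zero head entry gives an empty second sum.\<close>

function W :: "nat \<Rightarrow> nat list \<Rightarrow> nat" where
  "W p (l # L) = (\<Sum>h<p. W h ((l + p - 1 - h) # L))
     + (\<Sum>(a, b)\<in>{(a, b). a + b + 1 = l}. W p (nz [a, b] @ L))"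
| "W 0 [] = 1"
| "W (Suc p) [] = W p [] + (\<Sum>h<p. W h [p - h])"
  by pat_completeness auto
termination
  by (relation "measure (\<lambda>(p, L). p + sum_list L)") auto

text \<open>A path from a given state is the list of its transitions, each recorded as its index
  together with its target.\<close>

type_synonym path = "(move \<times> state) list"

fun is_path :: "state \<Rightarrow> path \<Rightarrow> bool" where
  "is_path s [] \<longleftrightarrow> True"
| "is_path s ((m, s') # ts) \<longleftrightarrow> transition s m s' \<and> is_path s' ts"

definition visited :: "state \<Rightarrow> path \<Rightarrow> state list" where
  "visited s ts = s # map snd ts"

definition exposure :: "nat list \<Rightarrow> state \<Rightarrow> bool" where
  "exposure L s \<longleftrightarrow> snd s = L"

definition stopped :: "nat list \<Rightarrow> state \<Rightarrow> path \<Rightarrow> bool" where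
  "stopped L s ts \<longleftrightarrow> is_path s ts \<and> exposure L (last (visited s ts))
     \<and> (\<forall>s'\<in>set (butlast (visited s ts)). \<not> exposure L s')"

definition stopped_paths :: "nat list \<Rightarrow> nat list \<Rightarrow> nat \<Rightarrow> nat \<Rightarrow> path set" where
  "stopped_paths L U p t =
     {ts. stopped L (p, U @ L) ts \<and> last (visited (p, U @ L) ts) = (t, L)}"

type_synonym kernel = "nat \<Rightarrow> nat \<Rightarrow> nat"

definition KL :: "nat list \<Rightarrow> nat list \<Rightarrow> kernel" where
  "KL L U p t = card (stopped_paths L U p t)"

definition id_kernel :: kernel where
  "id_kernel p t = (if p = t then 1 else 0)"

text \<open>The suffix-independent kernel; the empty suffix serves as representative.\<close>

definition K :: "nat list \<Rightarrow> kernel" where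
  "K U = (if U = [] then id_kernel else KL [] U)"

text \<open>Series of naturals, in the discrete topology; convergence means finite support.\<close>

definition kernel_mult :: "kernel \<Rightarrow> kernel \<Rightarrow> kernel"  (infixr \<open>\<bullet>\<close> 70) where
  "(A \<bullet> B) p t = (\<Sum>u. A p u * B u t)"

definition kernel_prod :: "kernel list \<Rightarrow> kernel" where
  "kernel_prod As = foldr (\<bullet>) As id_kernel"

end

theory Submission
  imports Defs
begin

text \<open>
  Above a marked suffix \<open>L\<close>, a transition from \<open>(p, (l # U) @ L)\<close> only rewrites the head \<open>l\<close>, so
  splitting a stopped path at its first transition yields for \<open>K\<^sub>U\<^sup>L(p, t)\<close> the very recursion that
  defines \<open>W\<^sub>p\<close> on nonempty lists (\<open>head_recursive_KL\<close>). Every function \<open>F\<close> obeying this recursion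
  is linear in its values at the moment the stack has been consumed down to \<open>L\<close>, and the
  coefficients are the stopped path counts:
  \<open>F\<^sub>p(UL) = \<Sum>\<^sub>t K\<^sub>U(p, t) F\<^sub>t(L)\<close> (\<open>head_recursive_append\<close>).

  Everything follows by choosing \<open>F\<close>. Taking \<open>F = W\<close> gives the expansion of \<open>W\<^sub>p(UL)\<close>; taking
  \<open>F\<^sub>p(V) = K\<^sub>V(p, t)\<close> gives \<open>K\<^sub>U\<^sub>V = K\<^sub>U K\<^sub>V\<close>; taking \<open>F\<^sub>p(V) = K\<^sub>V\<^sup>L(p, t)\<close>, evaluated at \<open>V = U\<close> with
  nothing left over, gives \<open>K\<^sub>U\<^sup>L = K\<^sub>U\<close>. The control never increases, so \<open>K\<^sub>U(p, t) = 0\<close> for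
  \<open>t > p\<close> and every series is a finite sum.
\<close>

definition head_recursive :: "(nat \<Rightarrow> nat list \<Rightarrow> nat) \<Rightarrow> bool" where
  "head_recursive F \<longleftrightarrow> (\<forall>p l U. F p (l # U) =
     (\<Sum>h<p. F h ((l + p - 1 - h) # U))
     + (\<Sum>(a, b)\<in>{(a, b). a + b + 1 = l}. F p (nz [a, b] @ U)))"

lemma head_recursiveD:
  "head_recursive F \<Longrightarrow> F p (l # U) =
     (\<Sum>h<p. F h ((l + p - 1 - h) # U))
     + (\<Sum>(a, b)\<in>{(a, b). a + b + 1 = l}. F p (nz [a, b] @ U))"
  unfolding head_recursive_def by blast

text \<open>Induction along the transitions that rewrite the head; the control plus the sum of the
  stack drops along each of them.\<close>

lemma head_induct [case_names Nil Cons]: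
  assumes Nil: "\<And>p. P p []"
    and Cons: "\<And>p l U. (\<And>h. h < p \<Longrightarrow> P h ((l + p - 1 - h) # U))
      \<Longrightarrow> (\<And>a b. a + b + 1 = l \<Longrightarrow> P p (nz [a, b] @ U)) \<Longrightarrow> P p (l # U)"
  shows "P p U"
proof (induction "p + sum_list U" arbitrary: p U rule: less_induct)
  case less
  show ?case
  proof (cases U)
    case (Cons l V)
    have "P p (l # V)"
      by (rule assms(2); rule less) (auto simp: Cons)
    then show ?thesis by (simp add: Cons)
  qed (simp add: Nil)
qed

lemma finite_splittings: "finite {(a, b). a + b + 1 = (l::nat)}"
  by (rule finite_subset[of _ "{..l} \<times> {..l}"]) auto

section \<open>Splitting a stopped path at its first transition\<close>

lemma stopped_Nil: "stopped L s [] \<longleftrightarrow> exposure L s"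
  by (simp add: stopped_def visited_def)

lemma stopped_Cons:
  "stopped L s ((m, s') # ts) \<longleftrightarrow> \<not> exposure L s \<and> transition s m s' \<and> stopped L s' ts"
  by (auto simp: stopped_def visited_def)

lemma last_visited_Cons: "last (visited s ((m, s') # ts)) = last (visited s' ts)"
  by (simp add: visited_def)

text \<open>With nothing above the suffix the start is already an exposure, so a stopped path cannot
  move. Counting paths therefore reproduces the convention that the kernel of the empty list is
  the identity, and the empty list can serve as the base case of every induction below.\<close>

lemma stopped_paths_Nil: "stopped_paths L [] p t = (if p = t then {[]} else {})"
proof -
  have "stopped L (p, L) ts \<longleftrightarrow> ts = []" for ts
    by (cases ts) (auto simp: stopped_Nil stopped_Cons exposure_def)
  then show ?thesis
    by (auto simp: stopped_paths_def visited_def)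
qed

lemma transition_Cons_iff:
  "transition (p, l # U) m s' \<longleftrightarrow>
     (\<exists>h<p. m = Base h \<and> s' = (h, (l + p - 1 - h) # U))
     \<or> (\<exists>a b. a + b + 1 = l \<and> m = Head a b \<and> s' = (p, nz [a, b] @ U))"
  by (auto elim: transition.cases intro: transition.base_Cons[simplified] transition.active_head)

text \<open>The start \<open>(p, (l # U) @ L)\<close> is not an exposure of \<open>L\<close>, since its stack is longer. Hence
  there is a first transition, and it leads again to a stack with the suffix \<open>L\<close>; if nothing is
  left above \<open>L\<close>, then the path ends there.\<close>

lemma stopped_paths_Cons:
  "stopped_paths L (l # U) p t =
     (\<lambda>(h, ts). (Base h, (h, (l + p - 1 - h) # U @ L)) # ts) `
       (SIGMA h:{..<p}. stopped_paths L ((l + p - 1 - h) # U) h t)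
     \<union> (\<lambda>((a, b), ts). (Head a b, (p, nz [a, b] @ U @ L)) # ts) `
       (SIGMA (a, b):{(a, b). a + b + 1 = l}. stopped_paths L (nz [a, b] @ U) p t)"
  (is "_ = ?B ` ?SB \<union> ?H ` ?SH")
proof (rule set_eqI)
  fix ts
  have not_exposure: "\<not> exposure L (p, l # U @ L)"
    by (auto simp: exposure_def dest: arg_cong[where f = length])
  show "ts \<in> stopped_paths L (l # U) p t \<longleftrightarrow> ts \<in> ?B ` ?SB \<union> ?H ` ?SH"
  proof (cases ts)
    case Nil
    then show ?thesis
      using not_exposure by (auto simp: stopped_paths_def stopped_Nil)
  next
    case (Cons x us)
    obtain m s' where x: "x = (m, s')" by (cases x)
    have "ts \<in> stopped_paths L (l # U) p t \<longleftrightarrow>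
        transition (p, l # U @ L) m s' \<and> stopped L s' us \<and> last (visited s' us) = (t, L)"
      using not_exposure by (simp add: stopped_paths_def Cons x stopped_Cons last_visited_Cons)
    also have "\<dots> \<longleftrightarrow> ts \<in> ?B ` ?SB \<union> ?H ` ?SH"
      by (cases m) (auto simp: transition_Cons_iff Cons x stopped_paths_def image_iff)
    finally show ?thesis .
  qed
qed

lemma finite_stopped_paths: "finite (stopped_paths L U p t)"
proof (induction p U rule: head_induct)
  case (Nil p)
  then show ?case by (simp add: stopped_paths_Nil)
next
  case (Cons p l U)
  then show ?case
    by (subst stopped_paths_Cons, intro finite_UnI finite_imageI finite_SigmaI finite_splittings)
      auto
qed

lemma KL_Nil: "KL L [] = id_kernel"
  by (intro ext) (simp add: KL_def stopped_paths_Nil id_kernel_def)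

lemma head_recursive_KL: "head_recursive (\<lambda>p U. KL L U p t)"
  unfolding head_recursive_def
proof (intro allI)
  fix p l U
  let ?B = "\<lambda>(h, ts). (Base h, (h, (l + p - 1 - h) # U @ L)) # ts"
  let ?SB = "SIGMA h:{..<p}. stopped_paths L ((l + p - 1 - h) # U) h t"
  let ?H = "\<lambda>((a, b), ts). (Head a b, (p, nz [a, b] @ U @ L)) # ts"
  let ?SH = "SIGMA (a, b):{(a, b). a + b + 1 = l}. stopped_paths L (nz [a, b] @ U) p t"
  have fin_B: "finite ?SB"
    by (rule finite_SigmaI) (auto simp: finite_stopped_paths)
  have fin_H: "finite ?SH"
    by (rule finite_SigmaI[OF finite_splittings]) (auto simp: finite_stopped_paths)
  have "KL L (l # U) p t = card (?B ` ?SB) + card (?H ` ?SH)"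
    by (subst KL_def, subst stopped_paths_Cons, intro card_Un_disjoint finite_imageI fin_B fin_H)
      auto
  also have "card (?B ` ?SB) = card ?SB"
    by (intro card_image inj_onI) auto
  also have "\<dots> = (\<Sum>h<p. KL L ((l + p - 1 - h) # U) h t)"
    by (simp add: card_SigmaI finite_stopped_paths KL_def)
  also have "card (?H ` ?SH) = card ?SH"
    by (intro card_image inj_onI) auto
  also have "\<dots> = (\<Sum>(a, b)\<in>{(a, b). a + b + 1 = l}. KL L (nz [a, b] @ U) p t)"
    by (subst card_SigmaI[OF finite_splittings])
      (auto simp: finite_stopped_paths KL_def intro!: sum.cong)
  finally show "KL L (l # U) p t =
      (\<Sum>h<p. KL L ((l + p - 1 - h) # U) h t)
      + (\<Sum>(a, b)\<in>{(a, b). a + b + 1 = l}. KL L (nz [a, b] @ U) p t)" .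
qed

section \<open>Expansion of solutions of the head recursion\<close>

lemma K_eq_KL: "K U = KL [] U"
  by (simp add: K_def KL_Nil)

lemma head_recursive_K: "head_recursive (\<lambda>p U. K U p t)"
  unfolding K_eq_KL by (rule head_recursive_KL)

lemma K_Nil: "K [] = id_kernel"
  by (simp add: K_def)

lemma K_eq_0: "p < t \<Longrightarrow> K U p t = 0"
proof (induction p U rule: head_induct)
  case (Nil p)
  then show ?case by (simp add: K_Nil id_kernel_def)
next
  case (Cons p l U)
  show ?case
    by (subst head_recursiveD[OF head_recursive_K]) (use Cons in \<open>auto intro!: sum.neutral\<close>)
qed

text \<open>Both sides satisfy the head recursion in \<open>U\<close> and agree at \<open>U = []\<close>. In the terms with
  \<open>h < p\<close> the summation range \<open>t \<le> h\<close> may be enlarged to \<open>t \<le> p\<close>, so that the order of summation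
  can be exchanged.\<close>

lemma head_recursive_append:
  assumes F: "head_recursive F"
  shows "F p (U @ L) = (\<Sum>t\<le>p. K U p t * F t L)"
proof (induction p U rule: head_induct)
  case (Nil p)
  then show ?case
    by (simp add: K_Nil id_kernel_def if_distrib[of "\<lambda>x. x * _"] cong: if_cong)
next
  case (Cons p l U)
  have "F p ((l # U) @ L) =
      (\<Sum>h<p. F h (((l + p - 1 - h) # U) @ L))
      + (\<Sum>(a, b)\<in>{(a, b). a + b + 1 = l}. F p ((nz [a, b] @ U) @ L))"
    using head_recursiveD[OF F, of p l "U @ L"] by simp
  also have "(\<Sum>h<p. F h (((l + p - 1 - h) # U) @ L)) =
      (\<Sum>h<p. \<Sum>t\<le>p. K ((l + p - 1 - h) # U) h t * F t L)"
  proof (rule sum.cong)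
    fix h assume "h \<in> {..<p}"
    then have "h < p" by simp
    have "(\<Sum>t\<le>h. K ((l + p - 1 - h) # U) h t * F t L) =
        (\<Sum>t\<le>p. K ((l + p - 1 - h) # U) h t * F t L)"
      by (rule sum.mono_neutral_left) (use \<open>h < p\<close> in \<open>auto simp: K_eq_0\<close>)
    then show "F h (((l + p - 1 - h) # U) @ L) =
        (\<Sum>t\<le>p. K ((l + p - 1 - h) # U) h t * F t L)"
      using Cons.IH(1)[OF \<open>h < p\<close>] by simp
  qed simp
  also have "(\<Sum>(a, b)\<in>{(a, b). a + b + 1 = l}. F p ((nz [a, b] @ U) @ L)) =
      (\<Sum>(a, b)\<in>{(a, b). a + b + 1 = l}. \<Sum>t\<le>p. K (nz [a, b] @ U) p t * F t L)"
  proof (rule sum.cong)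
    fix x assume "x \<in> {(a, b). a + b + 1 = l}"
    then show "(case x of (a, b) \<Rightarrow> F p ((nz [a, b] @ U) @ L)) =
        (case x of (a, b) \<Rightarrow> \<Sum>t\<le>p. K (nz [a, b] @ U) p t * F t L)"
      using Cons.IH(2) by auto
  qed simp
  also have "(\<Sum>h<p. \<Sum>t\<le>p. K ((l + p - 1 - h) # U) h t * F t L) + \<dots> =
      (\<Sum>t\<le>p. K (l # U) p t * F t L)"
    \<comment> \<open>Fixing the inner range in the exchange rule keeps it from undoing itself.\<close>
    by (simp only: head_recursiveD[OF head_recursive_K, where p = p and l = l and U = U] split_def
        sum.distrib sum_distrib_right distrib_right sum.swap[where B = "{..p}"])
  finally show ?case .
qed

text \<open>The same expansion as a series, which is the form of the entries of a kernel product.\<close>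

lemma head_recursive_sums:
  assumes "head_recursive F"
  shows "(\<lambda>t. K U p t * F t L) sums F p (U @ L)"
  unfolding head_recursive_append[OF assms]
  by (rule sums_finite) (auto simp: K_eq_0)

section \<open>Stopped path kernels and their products\<close>

lemma head_recursive_W: "head_recursive W"
  unfolding head_recursive_def by (intro allI W.simps(1))

lemma KL_eq_K: "KL L U p t = K U p t"
proof -
  have "KL L (U @ []) p t = (\<Sum>u\<le>p. K U p u * KL L [] u t)"
    by (rule head_recursive_append[OF head_recursive_KL])
  also have "\<dots> = (\<Sum>u\<le>p. if u = t then K U p t else 0)"
    by (intro sum.cong) (auto simp: KL_Nil id_kernel_def)
  also have "\<dots> = K U p t"
    by (simp add: K_eq_0)
  finally show ?thesis by simp
qed

lemma K_append_sums: "(\<lambda>u. K U p u * K V u t) sums K (U @ V) p t"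
  by (rule head_recursive_sums[OF head_recursive_K])

lemma K_append: "K (U @ V) = K U \<bullet> K V"
  by (intro ext) (simp add: kernel_mult_def sums_unique[OF K_append_sums])

lemma K_eq_kernel_prod: "K ls = kernel_prod (map (\<lambda>l. K [l]) ls)"
proof (induction ls)
  case Nil
  then show ?case by (simp add: K_Nil kernel_prod_def)
next
  case (Cons l ls)
  have "K (l # ls) = K [l] \<bullet> K ls"
    using K_append[of "[l]" ls] by simp
  also have "\<dots> = kernel_prod (map (\<lambda>l. K [l]) (l # ls))"
    by (subst Cons.IH) (simp add: kernel_prod_def)
  finally show ?case .
qed

theorem theorem2p14:
  "(\<forall>U L L' p t. U \<noteq> [] \<longrightarrow> positive U \<longrightarrow> positive L \<longrightarrow> positive L' \<longrightarrow>
       finite (stopped_paths L U p t) \<and> KL L U p t = KL L' U p t)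
   \<and> (\<forall>U L p. positive U \<longrightarrow> positive L \<longrightarrow>
       (\<lambda>t. K U p t * W t L) sums W p (U @ L))
   \<and> (\<forall>U V. positive U \<longrightarrow> positive V \<longrightarrow>
       (\<forall>p t. summable (\<lambda>u. K U p u * K V u t)) \<and> K (U @ V) = K U \<bullet> K V)
   \<and> (\<forall>ls. positive ls \<longrightarrow> K ls = kernel_prod (map (\<lambda>l. K [l]) ls))
   \<and> (\<forall>ls p. positive ls \<longrightarrow>
       (\<lambda>t. kernel_prod (map (\<lambda>l. K [l]) ls) p t * W t []) sums W p ls)"
proof (intro conjI allI impI)
  fix U L p t
  show "finite (stopped_paths L U p t)"
    by (rule finite_stopped_paths)
next
  fix U L L' p t
  show "KL L U p t = KL L' U p t"
    by (simp add: KL_eq_K)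
next
  fix U L p
  show "(\<lambda>t. K U p t * W t L) sums W p (U @ L)"
    by (rule head_recursive_sums[OF head_recursive_W])
next
  fix U V p t
  show "summable (\<lambda>u. K U p u * K V u t)"
    by (rule sums_summable[OF K_append_sums])
next
  fix U V
  show "K (U @ V) = K U \<bullet> K V"
    by (rule K_append)
next
  fix ls
  show "K ls = kernel_prod (map (\<lambda>l. K [l]) ls)"
    by (rule K_eq_kernel_prod)
next
  fix ls p
  show "(\<lambda>t. kernel_prod (map (\<lambda>l. K [l]) ls) p t * W t []) sums W p ls"
    using head_recursive_sums[OF head_recursive_W, of ls p "[]"]
    by (simp add: K_eq_kernel_prod[symmetric])
qed

end
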